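(* Let $d\ge0$, let $f_0,\dots,f_d$ (indexed by powers of the parameter) be germs of holomorphic maps $(\mathbb C,0)\to(\mathbb C,0)$ of valuation at least $2$, let $\alpha\in\mathbb R\setminus\mathbb Q$, and for $t\in\mathbb C$ let $$f_t(z)=e^{2\pi i\alpha}z+\sum_{k=0}^dt^kf_k(z).$$ Then for every $\beta\in\mathbb T=\mathbb R/\mathbb Z$ one of the following two alternatives holds: 1) For all $t\in\mathbb C$, $\beta\in G(f_t)$. 2) There is a polar set $E\subset\mathbb C$ such that $\beta\notin G(f_t)$ for every $t\in\mathbb C\setminus E$.
   Context: $\mathrm{Diff}(\mathbb C,0)$ is the group under composition of germs of holomorphic maps $g$ at $0\in\mathbb C$ with $g(0)=0$, $g'(0)\ne0$. For $f\in\mathrm{Diff}(\mathbb C,0)$, $\mathrm{Cent}(f)=\{g\in\mathrm{Diff}(\mathbb C,0): g\circ f=f\circ g\}$, and $G(f)\subset\mathbb T$ is the set of rotation numbers of elements of the centralizer: $G(f)=\{\beta\in\mathbb T:\ \exists g\in\mathrm{Cent}(f),\ g'(0)=e^{2\pi i\beta}\}$. A set $E\subset\mathbb C$ is polar if it has zero logarithmic capacity, i.e. $\iint\log|z-w|\,d\mu(z)d\mu(w)=-\infty$ for every Borel probability measure $\mu$ with compact support in $E$. *)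

theory Defs
  imports "HOL-Complex_Analysis.Complex_Analysis" "HOL-Probability.Probability"
begin

section \<open>Germs of holomorphic maps fixing the origin\<close>

text \<open>
  Germs at 0 are handled through representatives: total functions that are analytic in a
  neighbourhood of 0, where equality of germs is equality near 0.  The notions below depend
  only on the germs; see lemmas \<open>Diff0_cong\<close> and \<open>Cent_cong\<close>.
\<close>

definition germs0 :: "(complex \<Rightarrow> complex) set" where
  "germs0 = {f. f analytic_on {0} \<and> f 0 = 0}"

text \<open>The order of vanishing at 0; the zero germ has valuation \<open>\<infinity>\<close>.\<close>

definition valuation :: "(complex \<Rightarrow> complex) \<Rightarrow> enat" where
  "valuation f = (INF n\<in>{n. (deriv ^^ n) f 0 \<noteq> 0}. enat n)"

definition Diff0 :: "(complex \<Rightarrow> complex) set" where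
  "Diff0 = {g \<in> germs0. deriv g 0 \<noteq> 0}"

definition Cent :: "(complex \<Rightarrow> complex) \<Rightarrow> (complex \<Rightarrow> complex) set" where
  "Cent f = {g \<in> Diff0. \<forall>\<^sub>F z in nhds 0. g (f z) = f (g z)}"

text \<open>
  Elements of the circle \<open>\<real>/\<int>\<close> are given by real representatives, so the following set is the
  preimage in \<open>\<real>\<close> of the set of rotation numbers; see lemma \<open>rotation_numbers_add_int\<close>.
\<close>

definition rotation_numbers :: "(complex \<Rightarrow> complex) \<Rightarrow> real set" where
  "rotation_numbers f =
     {\<beta>. \<exists>g\<in>Cent f. deriv g 0 = exp (2 * of_real pi * \<i> * of_real \<beta>)}"

definition perturbation ::
    "real \<Rightarrow> nat \<Rightarrow> (nat \<Rightarrow> complex \<Rightarrow> complex) \<Rightarrow> complex \<Rightarrow> complex \<Rightarrow> complex" where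
  "perturbation \<alpha> d f t z =
     exp (2 * of_real pi * \<i> * of_real \<alpha>) * z + (\<Sum>k=0..d. t ^ k * f k z)"

lemma Diff0_cong:
  assumes "\<forall>\<^sub>F z in nhds 0. f z = g z"
  shows "f \<in> Diff0 \<longleftrightarrow> g \<in> Diff0"
  using assms eventually_nhds_x_imp_x[OF assms] analytic_at_cong[OF assms refl]
    deriv_cong_ev[OF assms refl]
  by (simp add: Diff0_def germs0_def)

lemma Diff0_tendsto_0:
  assumes "f \<in> Diff0"
  shows "filterlim f (nhds 0) (nhds 0)"
proof -
  have "isCont f 0"
    using assms by (auto simp: Diff0_def germs0_def intro: analytic_at_imp_isCont)
  then show ?thesis
    using assms by (simp add: Diff0_def germs0_def continuous_at tendsto_at_iff_tendsto_nhds)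
qed

lemma Cent_cong:
  assumes "f \<in> Diff0" and f: "\<forall>\<^sub>F z in nhds 0. f z = f' z" and g: "\<forall>\<^sub>F z in nhds 0. g z = g' z"
  shows "g \<in> Cent f \<longleftrightarrow> g' \<in> Cent f'"
proof (cases "g \<in> Diff0")
  case True
  have "\<forall>\<^sub>F z in nhds 0. g (f z) = g' (f' z)"
    using f eventually_compose_filterlim[OF g Diff0_tendsto_0[OF assms(1)]]
    by eventually_elim simp
  moreover have "\<forall>\<^sub>F z in nhds 0. f (g z) = f' (g' z)"
    using g eventually_compose_filterlim[OF f Diff0_tendsto_0[OF True]]
    by eventually_elim simp
  ultimately have "\<forall>\<^sub>F z in nhds 0. (g (f z) = f (g z)) = (g' (f' z) = f' (g' z))"
    by eventually_elim simp
  then have "(\<forall>\<^sub>F z in nhds 0. g (f z) = f (g z)) \<longleftrightarrow> (\<forall>\<^sub>F z in nhds 0. g' (f' z) = f' (g' z))"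
    by (rule eventually_subst)
  then show ?thesis
    using Diff0_cong[OF g] by (simp add: Cent_def)
next
  case False
  then show ?thesis
    using Diff0_cong[OF g] by (simp add: Cent_def)
qed

lemma rotation_numbers_add_int:
  "\<beta> + of_int n \<in> rotation_numbers f \<longleftrightarrow> \<beta> \<in> rotation_numbers f"
proof -
  have "exp (2 * of_real pi * \<i> * of_real (\<beta> + of_int n)) =
        exp (2 * of_real pi * \<i> * of_real \<beta>)"
    by (auto simp: exp_eq algebra_simps)
  then show ?thesis
    by (simp add: rotation_numbers_def)
qed


section \<open>Polar sets\<close>

definition ereal_ln :: "real \<Rightarrow> ereal" where
  "ereal_ln x = (if x \<le> 0 then -\<infinity> else ereal (ln x))"

text \<open>
  The double integral of \<open>log |z - w|\<close>, as the difference of the integrals of the positive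
  and the negative part (\<^const>\<open>e2ennreal\<close> sends negative numbers to 0).  For a finite measure
  of compact support, the first of these is finite.
\<close>

definition log_energy :: "complex measure \<Rightarrow> ereal" where
  "log_energy \<mu> =
     enn2ereal (\<integral>\<^sup>+ w. (\<integral>\<^sup>+ z. e2ennreal (ereal_ln (cmod (z - w))) \<partial>\<mu>) \<partial>\<mu>) -
     enn2ereal (\<integral>\<^sup>+ w. (\<integral>\<^sup>+ z. e2ennreal (- ereal_ln (cmod (z - w))) \<partial>\<mu>) \<partial>\<mu>)"

definition measure_support :: "'a::topological_space measure \<Rightarrow> 'a set" where
  "measure_support \<mu> = {x. \<forall>U. open U \<longrightarrow> x \<in> U \<longrightarrow> emeasure \<mu> U > 0}"

definition polar :: "complex set \<Rightarrow> bool" where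
  "polar E \<longleftrightarrow>
     (\<forall>\<mu>. prob_space \<mu> \<longrightarrow> sets \<mu> = sets borel \<longrightarrow>
          compact (measure_support \<mu>) \<longrightarrow> measure_support \<mu> \<subseteq> E \<longrightarrow>
          log_energy \<mu> = -\<infinity>)"

end

(*
  Since exp(2 pi i alpha) is not a root of unity, f_t commutes with exactly one formal power series
  g_t with linear coefficient exp(2 pi i beta), and its n-th coefficient is a polynomial in t of
  degree at most d n.  So beta belongs to G(f_t) iff these coefficients grow at most geometrically
  in n.  If this happens on a non-polar set of t, then it happens with a uniform constant C on a
  compact set K that carries a measure of bounded logarithmic potential, and a Bernstein-Walsh
  inequality carries the bound C^n from K to every t.
*)

theory Submission
  imports Defs "HOL-Computational_Algebra.Fundamental_Theorem_Algebra"
begin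

unbundle no vec_syntax

section \<open>Commuting power series\<close>

text \<open>No small-divisor estimate enters. In the equation for the n-th coefficient the unknown
  carries only the factor \<kappa>^n - \<kappa>, where \<kappa> = exp(2 pi i alpha). This factor is
  independent of t, so dividing by it preserves polynomials in t however small it is. Linear growth
  of the degree matters because the loss exp(C deg) in the Bernstein-Walsh inequality is then again
  geometric in n. The delicate point is that the roots of these polynomials lie anywhere in the
  plane, whereas finite energy controls the logarithmic potential only almost everywhere. Hence the
  passage to a compact set on which the potential is bounded. A root off this set is compared with
  its nearest point in the set, at the price of a factor 2 in distances; distant roots are
  harmless.\<close>

lemma fps_mult_nth_eq_0:
  fixes A B :: "'a::comm_ring_1 fps"
  assumes "\<And>k. k < n \<Longrightarrow> A $ k = 0" "B $ 0 = 0"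
  shows "(A * B) $ n = 0"
proof -
  have "A $ i * B $ (n - i) = 0" if "i \<in> {0..n}" for i
    using assms that by (cases "i = n") auto
  then show ?thesis
    unfolding fps_mult_nth by (rule sum.neutral[OF ballI])
qed

text \<open>With T the truncation, G^i - T^i is G - T, of order at least n, times a sum of products
  of i - 1 factors G or T. For i >= 2 this cofactor has no constant term. For i = 1 the truncation
  itself removes the n-th coefficient.\<close>

lemma fps_cutoff_power_nth:
  fixes G :: "'a::comm_ring_1 fps"
  assumes "G $ 0 = 0" "i \<noteq> 1"
  shows "(fps_cutoff n G ^ i) $ n = (G ^ i) $ n"
proof (cases "i = 0")
  case False
  then have i: "i \<ge> 2"
    using assms(2) by simp
  let ?T = "fps_cutoff n G"
  have T0: "?T $ 0 = 0"
    using assms(1) by simp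
  have "(\<Sum>j<i. ?T ^ (i - Suc j) * G ^ j) $ 0 = 0"
    unfolding fps_sum_nth
  proof (rule sum.neutral, rule ballI)
    fix j assume "j \<in> {..<i}"
    then have "i - Suc j > 0 \<or> j > 0"
      using i by auto
    then show "(?T ^ (i - Suc j) * G ^ j) $ 0 = 0"
      using assms(1) T0 by (auto simp: fps_power_zeroth zero_power)
  qed
  then have "((G - ?T) * (\<Sum>j<i. ?T ^ (i - Suc j) * G ^ j)) $ n = 0"
    by (intro fps_mult_nth_eq_0) auto
  also have "(G - ?T) * (\<Sum>j<i. ?T ^ (i - Suc j) * G ^ j) = G ^ i - ?T ^ i"
    by (simp add: power_diff_sumr2)
  finally show ?thesis
    by simp
qed simp

text \<open>At order n, \<open>G $ n\<close> enters \<open>F oo G\<close> only through the linear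
  term of F, and \<open>G oo F\<close> only through the term with F^n, whose n-th coefficient is
  \<open>(F $ 1) ^ n\<close>. So the commutator is affine in the newest coefficient of G.\<close>

lemma commutator_nth_cutoff:
  fixes F G :: "'a::comm_ring_1 fps"
  assumes "F $ 0 = 0" "G $ 0 = 0" "n \<ge> 2"
  shows "((F oo G) - (G oo F)) $ n =
    ((F oo fps_cutoff n G) - (fps_cutoff n G oo F)) $ n - ((F $ 1) ^ n - F $ 1) * G $ n"
proof -
  have "(F oo G) $ n - (F oo fps_cutoff n G) $ n =
      (\<Sum>i=0..n. F $ i * ((G ^ i) $ n - (fps_cutoff n G ^ i) $ n))"
    by (simp add: fps_compose_nth sum_subtractf right_diff_distrib)
  also have "\<dots> = (\<Sum>i\<in>{1}. F $ i * ((G ^ i) $ n - (fps_cutoff n G ^ i) $ n))"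
    using assms fps_cutoff_power_nth[OF assms(2), of _ n] by (intro sum.mono_neutral_right) auto
  finally have 1: "(F oo G) $ n - (F oo fps_cutoff n G) $ n = F $ 1 * G $ n"
    by simp
  have "(G oo F) $ n - (fps_cutoff n G oo F) $ n =
      (\<Sum>i=0..n. (G $ i - fps_cutoff n G $ i) * (F ^ i) $ n)"
    by (simp add: fps_compose_nth sum_subtractf left_diff_distrib)
  also have "\<dots> = (\<Sum>i\<in>{n}. (G $ i - fps_cutoff n G $ i) * (F ^ i) $ n)"
    by (intro sum.mono_neutral_right) auto
  finally have 2: "(G oo F) $ n - (fps_cutoff n G oo F) $ n = G $ n * (F $ 1) ^ n"
    by (simp add: startsby_zero_power_nth_same assms)
  show ?thesis
    using 1 2 by (simp add: algebra_simps)
qed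

text \<open>Solves \<open>commutator_nth_cutoff\<close> with left side 0 for the newest coefficient.
  The truncation is spelled out with \<open>k < n\<close> so that the recursive calls visibly
  decrease. At a resonance, division by zero yields 0.\<close>

fun commuting_coeff :: "'a::field fps \<Rightarrow> 'a \<Rightarrow> nat \<Rightarrow> 'a" where
  "commuting_coeff F \<mu> n =
     (if n = 0 then 0 else if n = 1 then \<mu>
      else let T = Abs_fps (\<lambda>k. if k < n then commuting_coeff F \<mu> k else 0)
           in ((F oo T) - (T oo F)) $ n / ((F $ 1) ^ n - F $ 1))"

declare commuting_coeff.simps [simp del]

definition commuting_series :: "'a::field fps \<Rightarrow> 'a \<Rightarrow> 'a fps" where
  "commuting_series F \<mu> = Abs_fps (commuting_coeff F \<mu>)"

lemma commuting_series_nth_0 [simp]: "commuting_series F \<mu> $ 0 = 0"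
  by (simp add: commuting_series_def commuting_coeff.simps)

lemma commuting_series_nth_1 [simp]: "commuting_series F \<mu> $ Suc 0 = \<mu>"
  by (simp add: commuting_series_def commuting_coeff.simps)

lemma commuting_series_nth:
  assumes "n \<ge> 2"
  shows "commuting_series F \<mu> $ n =
    ((F oo fps_cutoff n (commuting_series F \<mu>)) - (fps_cutoff n (commuting_series F \<mu>) oo F)) $ n
      / ((F $ 1) ^ n - F $ 1)"
proof -
  have "Abs_fps (\<lambda>k. if k < n then commuting_coeff F \<mu> k else 0) =
      fps_cutoff n (commuting_series F \<mu>)"
    by (simp add: fps_eq_iff commuting_series_def)
  then show ?thesis
    using assms by (simp add: commuting_series_def commuting_coeff.simps[of F \<mu> n] Let_def)
qed

text \<open>Uniqueness is a strong induction, as equal lower coefficients give equal truncations.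
  Existence needs no induction: the recursion cancels each coefficient of the commutator.\<close>

lemma commutes_iff_commuting_series:
  fixes F G :: "'a::field fps"
  assumes F: "F $ 0 = 0" and nonres: "\<And>n. n \<ge> 2 \<Longrightarrow> (F $ 1) ^ n \<noteq> F $ 1"
    and G: "G $ 0 = 0"
  shows "G oo F = F oo G \<longleftrightarrow> G = commuting_series F (G $ 1)"
proof
  assume comm: "G oo F = F oo G"
  have "G $ n = commuting_series F (G $ 1) $ n" for n
  proof (induction n rule: less_induct)
    case (less n)
    consider "n = 0" | "n = 1" | "n \<ge> 2"
      by linarith
    then show ?case
    proof cases
      case 3
      have "fps_cutoff n G = fps_cutoff n (commuting_series F (G $ 1))"
        using less.IH by (simp add: fps_eq_iff)
      moreover have "((F oo G) - (G oo F)) $ n = 0"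
        using comm by simp
      ultimately show ?thesis
        unfolding commuting_series_nth[OF 3] commutator_nth_cutoff[OF F G 3]
        using nonres[OF 3] by (simp only: eq_divide_eq) (simp add: mult.commute)
    qed (use G in auto)
  qed
  then show "G = commuting_series F (G $ 1)"
    by (rule fps_ext)
next
  assume eq: "G = commuting_series F (G $ 1)"
  have "((F oo G) - (G oo F)) $ n = 0" for n
  proof -
    consider "n = 0" | "n = 1" | "n \<ge> 2"
      by linarith
    then show ?thesis
    proof cases
      case 3
      have "G $ n = ((F oo fps_cutoff n G) - (fps_cutoff n G oo F)) $ n / ((F $ 1) ^ n - F $ 1)"
        using commuting_series_nth[OF 3, of F "G $ 1"] unfolding eq[symmetric] .
      then show ?thesis
        unfolding commutator_nth_cutoff[OF F G 3] using nonres[OF 3]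
        by (simp only: eq_divide_eq) (simp add: mult.commute)
    qed (use F G in \<open>auto simp: fps_compose_nth\<close>)
  qed
  then show "G oo F = F oo G"
    by (simp add: fps_eq_iff)
qed

section \<open>Polynomial dependence on the parameter\<close>

definition polynomial_upto :: "nat \<Rightarrow> ('a::field \<Rightarrow> 'a) \<Rightarrow> bool" where
  "polynomial_upto N h \<longleftrightarrow> (\<exists>p. degree p \<le> N \<and> h = poly p)"

lemma polynomial_upto_const [intro]: "polynomial_upto N (\<lambda>_. c)"
  unfolding polynomial_upto_def by (intro exI[of _ "[:c:]"]) auto

lemma polynomial_upto_add:
  "polynomial_upto N g \<Longrightarrow> polynomial_upto N h \<Longrightarrow> polynomial_upto N (\<lambda>t. g t + h t)"
  unfolding polynomial_upto_def by (metis (no_types, lifting) degree_add_le ext poly_add)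

lemma polynomial_upto_diff:
  "polynomial_upto N g \<Longrightarrow> polynomial_upto N h \<Longrightarrow> polynomial_upto N (\<lambda>t. g t - h t)"
  unfolding polynomial_upto_def by (metis (no_types, lifting) degree_diff_le ext poly_diff)

lemma polynomial_upto_divide:
  assumes "polynomial_upto N g"
  shows "polynomial_upto N (\<lambda>t. g t / c)"
proof -
  obtain p where "degree p \<le> N" "g = poly p"
    using assms unfolding polynomial_upto_def by blast
  then show ?thesis
    unfolding polynomial_upto_def using degree_smult_le[of "inverse c" p]
    by (intro exI[of _ "smult (inverse c) p"]) (auto simp: divide_inverse mult.commute)
qed

lemma polynomial_upto_mult:
  assumes "polynomial_upto M g" "polynomial_upto N h" "M + N \<le> K"
  shows "polynomial_upto K (\<lambda>t. g t * h t)"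
proof -
  obtain p q where "degree p \<le> M" "g = poly p" "degree q \<le> N" "h = poly q"
    using assms(1,2) unfolding polynomial_upto_def by blast
  then show ?thesis
    using degree_mult_le[of p q] assms(3) unfolding polynomial_upto_def
    by (intro exI[of _ "p * q"]) auto
qed

lemma polynomial_upto_sum:
  "(\<And>i. i \<in> I \<Longrightarrow> polynomial_upto N (h i)) \<Longrightarrow> polynomial_upto N (\<lambda>t. \<Sum>i\<in>I. h i t)"
  by (induction I rule: infinite_finite_induct) (auto intro: polynomial_upto_add)

text \<open>
  The sharp bound \<open>d * (n - i)\<close>, rather than \<open>d * n\<close>, is what makes the degrees of
  coefficients add up correctly under composition.
\<close>

definition graded :: "nat \<Rightarrow> nat \<Rightarrow> ('a::field \<Rightarrow> 'a fps) \<Rightarrow> bool" where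
  "graded d i A \<longleftrightarrow> (\<forall>n. polynomial_upto (d * (n - i)) (\<lambda>t. A t $ n) \<and> (n < i \<longrightarrow> (\<forall>t. A t $ n = 0)))"

lemma gradedD:
  "graded d i A \<Longrightarrow> polynomial_upto (d * (n - i)) (\<lambda>t. A t $ n)"
  "graded d i A \<Longrightarrow> n < i \<Longrightarrow> A t $ n = 0"
  by (simp_all add: graded_def)

lemma graded_mult:
  assumes A: "graded d i A" and B: "graded d j B"
  shows "graded d (i + j) (\<lambda>t. A t * B t)"
proof -
  have "polynomial_upto (d * (n - (i + j))) (\<lambda>t. A t $ k * B t $ (n - k))" if "k \<le> n" for n k
  \<comment> \<open>Subtraction truncates at 0, so the two degree bounds may add up to too much when
    k < i or n - k < j; but then the product vanishes.\<close>
  proof (cases "k < i \<or> n - k < j")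
    case True
    then have "(\<lambda>t. A t $ k * B t $ (n - k)) = (\<lambda>_. 0)"
      using gradedD(2)[OF A] gradedD(2)[OF B] by auto
    then show ?thesis
      by auto
  next
    case False
    then have "(k - i) + (n - k - j) = n - (i + j)"
      using that by linarith
    then have "d * (k - i) + d * (n - k - j) \<le> d * (n - (i + j))"
      by (metis distrib_left order_refl)
    then show ?thesis
      by (rule polynomial_upto_mult[OF gradedD(1)[OF A] gradedD(1)[OF B]])
  qed
  moreover have "A t $ k * B t $ (n - k) = 0" if "n < i + j" "k \<le> n" for n k t
    using that gradedD(2)[OF A, of k] gradedD(2)[OF B, of "n - k"] by (cases "k < i") auto
  ultimately show ?thesis
    unfolding graded_def fps_mult_nth by (auto intro!: polynomial_upto_sum sum.neutral)
qed

lemma graded_power: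
  assumes "graded d 1 A"
  shows "graded d i (\<lambda>t. A t ^ i)"
proof (induction i)
  case 0
  show ?case
    by (auto simp: graded_def)
next
  case (Suc i)
  then show ?case
    using graded_mult[OF assms Suc] by simp
qed

lemma graded_compose:
  assumes A: "graded d 1 A" and B: "graded d 1 B"
  shows "graded d 1 (\<lambda>t. A t oo B t)"
proof -
  have "polynomial_upto (d * (n - 1)) (\<lambda>t. A t $ i * (B t ^ i) $ n)" if "i \<le> n" for i n
  \<comment> \<open>For i = 0 the truncated i - 1 would leave the degree bound d * n, too large by d
    when n > 0; but this term vanishes.\<close>
  proof (cases "i = 0")
    case True
    then have "(\<lambda>t. A t $ i * (B t ^ i) $ n) = (\<lambda>_. 0)"
      using gradedD(2)[OF A] by auto
    then show ?thesis
      by auto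
  next
    case False
    then have "(i - 1) + (n - i) = n - 1"
      using that by linarith
    then have "d * (i - 1) + d * (n - i) \<le> d * (n - 1)"
      by (metis distrib_left order_refl)
    then show ?thesis
      by (rule polynomial_upto_mult[OF gradedD(1)[OF A] gradedD(1)[OF graded_power[OF B]]])
  qed
  then show ?thesis
    using gradedD(2)[OF A] unfolding graded_def fps_compose_nth
    by (auto intro!: polynomial_upto_sum)
qed

text \<open>The linear coefficient \<kappa> is shared by all \<open>F t\<close>, so the divisors are
  constants and division does not raise the degree.\<close>

lemma graded_commuting_series:
  fixes F :: "'a::field \<Rightarrow> 'a fps"
  assumes F: "graded d 1 F" "\<And>t. F t $ 1 = \<kappa>"
  shows "graded d 1 (\<lambda>t. commuting_series (F t) \<mu>)"
proof -
  have "polynomial_upto (d * (n - 1)) (\<lambda>t. commuting_series (F t) \<mu> $ n)" for n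
  proof (induction n rule: less_induct)
    case (less n)
    consider "n = 0" | "n = 1" | "n \<ge> 2"
      by linarith
    then show ?case
    proof cases
      case 3
      define T where "T t = fps_cutoff n (commuting_series (F t) \<mu>)" for t
      have T: "graded d 1 T"
        unfolding graded_def
      proof (intro allI conjI impI)
        fix k
        show "polynomial_upto (d * (k - 1)) (\<lambda>t. T t $ k)"
          using less.IH[of k] by (cases "k < n") (auto simp: T_def)
      qed (auto simp: T_def)
      have "polynomial_upto (d * (n - 1)) (\<lambda>t. (F t oo T t) $ n)"
        "polynomial_upto (d * (n - 1)) (\<lambda>t. (T t oo F t) $ n)"
        using graded_compose[OF F(1) T] graded_compose[OF T F(1)] by (auto simp: graded_def)
      then have "polynomial_upto (d * (n - 1)) (\<lambda>t. ((F t oo T t) $ n - (T t oo F t) $ n) / (\<kappa> ^ n - \<kappa>))"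
        by (intro polynomial_upto_divide polynomial_upto_diff)
      then show ?thesis
        unfolding T_def commuting_series_nth[OF 3] by (simp only: F(2) fps_sub_nth)
    qed auto
  qed
  then show ?thesis
    by (simp add: graded_def)
qed

section \<open>Convergent commuting series and the centralizer\<close>

lemma fps_conv_radius_pos_iff:
  fixes G :: "complex fps"
  assumes G0: "G $ 0 = 0"
  shows "fps_conv_radius G > 0 \<longleftrightarrow> (\<exists>C::nat. \<forall>n. norm (G $ n) \<le> real C ^ n)"
proof
  assume "fps_conv_radius G > 0"
  then obtain r where r: "0 < ereal r" "ereal r < fps_conv_radius G"
    using ereal_dense2 by blast
  then have "summable (\<lambda>n. G $ n * of_real r ^ n)"
    by (intro summable_fps) auto
  then have "Bseq (\<lambda>n. G $ n * of_real r ^ n)"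
    using summable_LIMSEQ_zero convergent_imp_Bseq convergentI by blast
  then obtain B where B: "B > 0" "\<And>n. norm (G $ n * of_real r ^ n) \<le> B"
    by (auto elim: BseqE)
  \<comment> \<open>\<open>max 1 B\<close> absorbs the prefactor into the base, since B <= (max 1
    B)^n for n >= 1; the coefficient at n = 0 is zero. A natural C later makes the set of good
    parameters a countable union.\<close>
  define C where "C = nat \<lceil>max 1 B / r\<rceil>"
  have C: "max 1 B / r \<le> real C"
    unfolding C_def by linarith
  have "norm (G $ n) \<le> real C ^ n" for n
  proof (cases "n = 0")
    case False
    have "norm (G $ n) = norm (G $ n * of_real r ^ n) / r ^ n"
      using r by (simp add: norm_mult norm_power)
    also have "\<dots> \<le> max 1 B ^ n / r ^ n"
    proof (rule divide_right_mono)
      have "B \<le> max 1 B"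
        by simp
      moreover have "max 1 B \<le> max 1 B ^ n"
        using False by (intro self_le_power) auto
      ultimately show "norm (G $ n * of_real r ^ n) \<le> max 1 B ^ n"
        using B(2)[of n] by linarith
    qed (use r in auto)
    also have "\<dots> = (max 1 B / r) ^ n"
      by (simp add: power_divide)
    also have "\<dots> \<le> real C ^ n"
      using C r by (intro power_mono) auto
    finally show ?thesis .
  qed (use G0 in auto)
  then show "\<exists>C::nat. \<forall>n. norm (G $ n) \<le> real C ^ n"
    by blast
next
  assume "\<exists>C::nat. \<forall>n. norm (G $ n) \<le> real C ^ n"
  then obtain C :: nat where C: "\<And>n. norm (G $ n) \<le> real C ^ n"
    by blast
  \<comment> \<open>Gives C * r <= 1/2; the + 1 avoids a division by zero when C = 0.\<close>
  define r where "r = 1 / (2 * (real C + 1))"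
  have r: "r > 0"
    by (simp add: r_def)
  have "summable (\<lambda>n. G $ n * of_real r ^ n)"
  proof (rule summable_comparison_test')
    show "summable (\<lambda>n. (1 / 2 :: real) ^ n)"
      by (rule summable_geometric) simp
    show "norm (G $ n * of_real r ^ n) \<le> (1 / 2) ^ n" if "n \<ge> 0" for n
    proof -
      have "norm (G $ n * of_real r ^ n) = norm (G $ n) * r ^ n"
        using r by (simp add: norm_mult norm_power)
      also have "\<dots> \<le> real C ^ n * r ^ n"
        using C r by (intro mult_right_mono) auto
      also have "\<dots> = (real C * r) ^ n"
        by (simp add: power_mult_distrib)
      also have "\<dots> \<le> (1 / 2) ^ n"
        using r by (intro power_mono) (auto simp: r_def field_simps)
      finally show ?thesis .
    qed
  qed
  then have "fps_conv_radius G \<ge> norm (of_real r :: complex)"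
    unfolding fps_conv_radius_def by (rule conv_radius_geI)
  then show "fps_conv_radius G > 0"
    using r by (metis ereal_less(2) norm_of_real abs_of_pos order_less_le_trans)
qed

text \<open>The expansion of a centralizing germ commutes formally with F, so it is the commuting
  series. Conversely, a convergent commuting series sums to a germ for which both compositions have
  the same expansion, hence agree near 0.\<close>

lemma Cent_deriv_iff:
  assumes f: "f has_fps_expansion F" "F $ 0 = 0"
    and nonres: "\<And>n. n \<ge> 2 \<Longrightarrow> (F $ 1) ^ n \<noteq> F $ 1" and \<mu>: "\<mu> \<noteq> 0"
  shows "(\<exists>g\<in>Cent f. deriv g 0 = \<mu>) \<longleftrightarrow> fps_conv_radius (commuting_series F \<mu>) > 0"
proof
  assume "\<exists>g\<in>Cent f. deriv g 0 = \<mu>"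
  then obtain g where g: "g analytic_on {0}" "g 0 = 0" "deriv g 0 = \<mu>"
    and comm: "\<forall>\<^sub>F z in nhds 0. g (f z) = f (g z)"
    by (auto simp: Cent_def Diff0_def germs0_def)
  define G where "G = fps_expansion g 0"
  have G: "g has_fps_expansion G"
    using analytic_at_imp_has_fps_expansion_0[OF g(1)] by (simp add: G_def)
  have G01: "G $ 0 = 0" "G $ 1 = \<mu>"
    using fps_nth_fps_expansion[OF G, of 0] fps_nth_fps_expansion[OF G, of 1] g by auto
  have "(g \<circ> f) has_fps_expansion (G oo F)" "(f \<circ> g) has_fps_expansion (F oo G)"
    using has_fps_expansion_compose f G G01 by blast+
  moreover have "(g \<circ> f) has_fps_expansion H \<longleftrightarrow> (f \<circ> g) has_fps_expansion H" for H
    using comm by (intro has_fps_expansion_cong) auto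
  ultimately have "G oo F = F oo G"
    using fps_expansion_unique_complex by blast
  then have "G = commuting_series F \<mu>"
    using commutes_iff_commuting_series[OF f(2) nonres G01(1)] G01 by simp
  then show "fps_conv_radius (commuting_series F \<mu>) > 0"
    using G by (simp add: has_fps_expansion_def)
next
  define G where "G = commuting_series F \<mu>"
  define g where "g = eval_fps G"
  assume "fps_conv_radius (commuting_series F \<mu>) > 0"
  then have G: "g has_fps_expansion G"
    unfolding g_def G_def by (rule eval_fps_has_fps_expansion)
  have G01: "G $ 0 = 0" "G $ 1 = \<mu>"
    by (simp_all add: G_def)
  have g: "g 0 = 0" "deriv g 0 = \<mu>"
    using fps_nth_fps_expansion[OF G, of 0] fps_nth_fps_expansion[OF G, of 1] G01 by auto
  have "G oo F = F oo G"
    using commutes_iff_commuting_series[OF f(2) nonres G01(1)] G01 by (simp add: G_def)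
  moreover have "(g \<circ> f) has_fps_expansion (G oo F)" "(f \<circ> g) has_fps_expansion (F oo G)"
    using has_fps_expansion_compose f G G01 by blast+
  ultimately have "\<forall>\<^sub>F z in nhds 0. eval_fps (F oo G) z = (g \<circ> f) z"
    "\<forall>\<^sub>F z in nhds 0. eval_fps (F oo G) z = (f \<circ> g) z"
    by (auto simp: has_fps_expansion_def)
  then have "\<forall>\<^sub>F z in nhds 0. g (f z) = f (g z)"
    by eventually_elim simp
  then have "g \<in> Cent f"
    using g \<mu> has_fps_expansion_imp_analytic_0[OF G] by (auto simp: Cent_def Diff0_def germs0_def)
  with g show "\<exists>g\<in>Cent f. deriv g 0 = \<mu>"
    by blast
qed

text \<open>Equality would make (n - 1) * \<alpha> an integer.\<close>

lemma irrational_rotation_nonresonant: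
  assumes "\<alpha> \<notin> \<rat>" "n \<ge> 2"
  shows "exp (2 * of_real pi * \<i> * of_real \<alpha>) ^ n \<noteq> exp (2 * of_real pi * \<i> * of_real \<alpha>)"
proof
  assume "exp (2 * of_real pi * \<i> * of_real \<alpha>) ^ n = exp (2 * of_real pi * \<i> * of_real \<alpha>)"
  then have "exp (of_nat n * (2 * of_real pi * \<i> * of_real \<alpha>)) =
      exp (2 * of_real pi * \<i> * of_real \<alpha>)"
    by (simp only: exp_of_nat_mult)
  then obtain k :: int where "of_nat n * (2 * of_real pi * \<i> * of_real \<alpha>) =
      2 * of_real pi * \<i> * of_real \<alpha> + of_int (2 * k) * (of_real pi * \<i>)"
    by (auto simp: exp_eq)
  then have "Im (of_nat n * (2 * of_real pi * \<i> * of_real \<alpha>)) =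
      Im (2 * of_real pi * \<i> * of_real \<alpha> + of_int (2 * k) * (of_real pi * \<i>))"
    by (rule arg_cong)
  then have "2 * pi * (real n * \<alpha>) = 2 * pi * (\<alpha> + of_int k)"
    by (simp add: algebra_simps)
  then have "real n * \<alpha> = \<alpha> + of_int k"
    by simp
  then have "\<alpha> = of_int k / (real n - 1)"
    using assms(2) by (simp add: field_simps)
  then show False
    using assms(1) by auto
qed

lemma valuation_ge_2:
  assumes "valuation f \<ge> 2" "f has_fps_expansion F"
  shows "F $ 0 = 0" "F $ 1 = 0"
proof -
  have "(deriv ^^ n) f 0 = 0" if "n < 2" for n
  proof (rule ccontr)
    assume "(deriv ^^ n) f 0 \<noteq> 0"
    then have "valuation f \<le> enat n"
      unfolding valuation_def by (intro INF_lower) auto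
    then have "2 \<le> enat n"
      using assms(1) by (rule order_trans[rotated])
    then show False
      using that by (metis enat_ord_simps(1) numeral_eq_enat not_le)
  qed
  from this[of 0] this[of 1] show "F $ 0 = 0" "F $ 1 = 0"
    using fps_nth_fps_expansion[OF assms(2)] by auto
qed

lemma rotation_numbers_perturbation:
  fixes d :: nat and f :: "nat \<Rightarrow> complex \<Rightarrow> complex" and \<alpha> \<beta> :: real
  assumes germ: "\<And>k. k \<le> d \<Longrightarrow> f k \<in> germs0"
    and val: "\<And>k. k \<le> d \<Longrightarrow> valuation (f k) \<ge> 2"
    and irr: "\<alpha> \<notin> \<rat>"
  obtains p :: "nat \<Rightarrow> complex poly"
  where "\<And>n. degree (p n) \<le> d * n"
    and "\<And>t. \<beta> \<in> rotation_numbers (perturbation \<alpha> d f t) \<longleftrightarrow>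
           (\<exists>C::nat. \<forall>n. norm (poly (p n) t) \<le> real C ^ n)"
proof -
  define \<kappa> where "\<kappa> = exp (2 * of_real pi * \<i> * of_real \<alpha>)"
  define \<mu> where "\<mu> = exp (2 * of_real pi * \<i> * of_real \<beta>)"
  define F where "F k = fps_expansion (f k) 0" for k
  define P where "P t = fps_const \<kappa> * fps_X + (\<Sum>k=0..d. fps_const (t ^ k) * F k)" for t
  have F: "f k has_fps_expansion F k" if "k \<le> d" for k
    using germ[OF that] by (auto simp: F_def germs0_def intro: analytic_at_imp_has_fps_expansion_0)
  have F01: "F k $ 0 = 0" "F k $ Suc 0 = 0" if "k \<le> d" for k
    using valuation_ge_2[OF val[OF that] F[OF that]] by auto
  have P: "perturbation \<alpha> d f t has_fps_expansion P t" for t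
    unfolding perturbation_def P_def \<kappa>_def using F
    by (intro fps_expansion_intros) auto
  have nth: "P t $ n = (if n = 1 then \<kappa> else 0) + (\<Sum>k=0..d. t ^ k * F k $ n)" for t n
    by (simp add: P_def fps_sum_nth)
  have P01: "P t $ 0 = 0" "P t $ 1 = \<kappa>" for t
    using F01 by (simp_all add: nth)
  \<comment> \<open>At n = 1 the bound is degree 0: valuation at least 2 keeps t out of the linear
    term. For n >= 2 the degree in t is at most d <= d * (n - 1).\<close>
  have "polynomial_upto (d * (n - 1)) (\<lambda>t. P t $ n)" for n
  proof -
    consider "n = 0" | "n = 1" | "n \<ge> 2"
      by linarith
    then show ?thesis
    proof cases
      case 3
      have "polynomial_upto (d * (n - 1)) (\<lambda>t. t ^ k * F k $ n)" if "k \<le> d" for k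
      proof -
        have "d * 1 \<le> d * (n - 1)"
          using 3 by (intro mult_le_mono2) simp
        then have "degree (monom (F k $ n) k) \<le> d * (n - 1)"
          using that degree_monom_le[of "F k $ n" k] by linarith
        then show ?thesis
          unfolding polynomial_upto_def
          by (intro exI[of _ "monom (F k $ n) k"]) (auto simp: poly_monom fun_eq_iff)
      qed
      then show ?thesis
        using 3 by (auto simp: nth intro!: polynomial_upto_sum)
    qed (use P01 in auto)
  qed
  then have "graded d 1 P"
    using P01 by (simp add: graded_def)
  then have "graded d 1 (\<lambda>t. commuting_series (P t) \<mu>)"
    using P01 by (intro graded_commuting_series) auto
  then have "\<exists>p. degree p \<le> d * (n - 1) \<and> (\<lambda>t. commuting_series (P t) \<mu> $ n) = poly p" for n
    by (auto simp: graded_def polynomial_upto_def)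
  then obtain p where p: "\<And>n. degree (p n) \<le> d * (n - 1)"
    "\<And>n. (\<lambda>t. commuting_series (P t) \<mu> $ n) = poly (p n)"
    by metis
  show ?thesis
  proof
    show "degree (p n) \<le> d * n" for n
      using p(1)[of n] by (rule order_trans) simp
    fix t
    have "\<beta> \<in> rotation_numbers (perturbation \<alpha> d f t) \<longleftrightarrow>
        (\<exists>g\<in>Cent (perturbation \<alpha> d f t). deriv g 0 = \<mu>)"
      by (simp add: rotation_numbers_def \<mu>_def)
    also have "\<dots> \<longleftrightarrow> fps_conv_radius (commuting_series (P t) \<mu>) > 0"
      using irrational_rotation_nonresonant[OF irr] P01
      by (intro Cent_deriv_iff P) (auto simp: \<kappa>_def \<mu>_def)
    also have "\<dots> \<longleftrightarrow> (\<exists>C::nat. \<forall>n. norm (commuting_series (P t) \<mu> $ n) \<le> real C ^ n)"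
      by (rule fps_conv_radius_pos_iff) simp
    finally show "\<beta> \<in> rotation_numbers (perturbation \<alpha> d f t) \<longleftrightarrow>
        (\<exists>C::nat. \<forall>n. norm (poly (p n) t) \<le> real C ^ n)"
      by (simp add: p(2)[symmetric])
  qed
qed

section \<open>Polynomials and polar sets\<close>

lemma measurable_ereal_ln [measurable]: "ereal_ln \<in> borel_measurable borel"
  unfolding ereal_ln_def by measurable

text \<open>On reals \<open>ennreal\<close> is the positive part, which is subadditive.\<close>

lemma ennreal_add_le: "ennreal (a + b) \<le> ennreal a + ennreal b"
proof (cases "a \<ge> 0 \<and> b \<ge> 0")
  case False
  then have "a + b \<le> a \<or> a + b \<le> b"
    by auto
  then show ?thesis
    by (metis add.commute add_increasing2 ennreal_leI zero_le)
qed (simp add: ennreal_plus)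

text \<open>The positive part of \<open>log (\<bar>t - r\<bar> / \<bar>z - r\<bar>)\<close>; the junk value \<open>ln 0 = 0\<close> makes it 0 for \<open>t = r \<noteq> z\<close>.\<close>

definition log_ratio :: "complex \<Rightarrow> complex \<Rightarrow> complex \<Rightarrow> ennreal" where
  "log_ratio t r z = (if z = r then \<infinity> else ennreal (ln (cmod (t - r) / cmod (z - r))))"

lemma log_ratio_measurable [measurable]: "log_ratio t r \<in> borel_measurable borel"
  unfolding log_ratio_def[abs_def] by measurable

text \<open>Moves the pole from r to r', later a point of the compact set nearest to r, where the
  potential is bounded. The constant 6R is 3R, from |t - r|, times the 2 from comparing
  distances.\<close>

lemma log_ratio_near:
  assumes R: "R \<ge> 1" and t: "cmod (t - r) \<le> 3 * R"
    and z: "cmod (z - r') \<le> 2 * cmod (z - r)"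
  shows "log_ratio t r z \<le> e2ennreal (- ereal_ln (cmod (z - r'))) + ennreal (ln (6 * R))"
proof -
  consider "z = r'" | "t = r" "z \<noteq> r'" | "t \<noteq> r" "z \<noteq> r'"
    by blast
  then show ?thesis
  proof cases
    case 1
    then show ?thesis
      by (simp add: ereal_ln_def)
  next
    \<comment> \<open>Here z differs from r, since otherwise the hypothesis forces z = r'; so
      \<open>ln 0 = 0\<close> makes the left side 0.\<close>
    case 2
    then show ?thesis
      using z by (auto simp: log_ratio_def)
  next
    case 3
    then have pos: "cmod (z - r') > 0" "cmod (t - r) > 0" and "z \<noteq> r"
      using z by auto
    then have "cmod (t - r) / cmod (z - r) \<le> 3 * R / (cmod (z - r') / 2)"
      using t z R by (intro frac_le) auto
    then have "ln (cmod (t - r) / cmod (z - r)) \<le> ln (3 * R / (cmod (z - r') / 2))"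
      using pos \<open>z \<noteq> r\<close> R by (subst ln_le_cancel_iff) auto
    also have "\<dots> = - ln (cmod (z - r')) + ln (6 * R)"
      using pos R by (simp add: ln_div)
    finally have "log_ratio t r z \<le> ennreal (- ln (cmod (z - r')) + ln (6 * R))"
      using \<open>z \<noteq> r\<close> by (simp add: log_ratio_def ennreal_leI)
    also have "\<dots> \<le> ennreal (- ln (cmod (z - r'))) + ennreal (ln (6 * R))"
      by (rule ennreal_add_le)
    finally show ?thesis
      using pos by (simp add: ereal_ln_def)
  qed
qed

text \<open>Both distances are comparable to |r|, with quotient at most 3; the weaker 6R matches
  \<open>log_ratio_near\<close>.\<close>

lemma log_ratio_far:
  assumes R: "R \<ge> 1" "cmod t \<le> R" "cmod z \<le> R" "cmod r > 2 * R"
  shows "log_ratio t r z \<le> ennreal (ln (6 * R))"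
proof -
  have 1: "cmod (t - r) \<le> 3 / 2 * cmod r"
    using norm_triangle_ineq4[of t r] R by linarith
  have 2: "cmod (z - r) \<ge> cmod r / 2"
    using norm_triangle_ineq2[of r z] R by (simp add: norm_minus_commute)
  have 3: "cmod (t - r) > 0" "cmod r > 0"
    using R by auto
  have "cmod (t - r) / cmod (z - r) \<le> (3 / 2 * cmod r) / (cmod r / 2)"
    using 1 2 3 by (intro frac_le) auto
  also have "\<dots> \<le> 6 * R"
    using 3 R by simp
  finally have "ln (cmod (t - r) / cmod (z - r)) \<le> ln (6 * R)"
    using 2 3 R by (subst ln_le_cancel_iff) (auto intro!: divide_pos_pos)
  then show ?thesis
    using 2 3 by (auto simp: log_ratio_def intro: ennreal_leI)
qed

text \<open>C may depend on t but not on r, as the roots of the polynomials are uncontrolled. The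
  potential is bounded only at points of K, so a point of K has to replace r.\<close>

lemma log_ratio_integral_bounded:
  assumes M: "finite_measure M" "sets M = sets borel"
    and K: "compact K" "K \<noteq> {}" and B: "B < \<infinity>"
    and pot: "\<And>w. w \<in> K \<Longrightarrow> (\<integral>\<^sup>+z\<in>K. e2ennreal (- ereal_ln (cmod (z - w))) \<partial>M) \<le> B"
  shows "\<exists>C\<ge>0. \<forall>r. (\<integral>\<^sup>+z\<in>K. log_ratio t r z \<partial>M) \<le> ennreal C"
proof -
  interpret finite_measure M by fact
  note [measurable_cong] = M(2)
  have [measurable]: "K \<in> sets borel"
    using K(1) by (rule borel_compact)
  obtain R0 where R0: "\<And>z. z \<in> K \<Longrightarrow> cmod z \<le> R0"
    using compact_imp_bounded[OF K(1)] unfolding bounded_iff by blast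
  define R where "R = max 1 (max R0 (cmod t))"
  have R: "R \<ge> 1" "cmod t \<le> R" "\<And>z. z \<in> K \<Longrightarrow> cmod z \<le> R"
    using R0 by (fastforce simp: R_def)+
  define D where "D = B + ennreal (ln (6 * R)) * emeasure M K"
  have "(\<integral>\<^sup>+z\<in>K. log_ratio t r z \<partial>M) \<le> D" for r
  proof -
    have "\<exists>r'\<in>K. \<forall>z\<in>K. log_ratio t r z \<le> e2ennreal (- ereal_ln (cmod (z - r'))) + ennreal (ln (6 * R))"
    proof (cases "cmod r \<le> 2 * R")
      case True
      \<comment> \<open>For z in K, |z - r'| <= |z - r| + |r - r'| <= 2 |z - r|.\<close>
      obtain r' where r': "r' \<in> K" "\<And>z. z \<in> K \<Longrightarrow> dist r r' \<le> dist r z"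
        using distance_attains_inf[OF compact_imp_closed[OF K(1)] K(2)] by blast
      have "cmod (t - r) \<le> 3 * R"
        using norm_triangle_ineq4[of t r] True R by linarith
      moreover have "cmod (z - r') \<le> 2 * cmod (z - r)" if "z \<in> K" for z
        using r'(2)[OF that] dist_triangle[of z r' r] by (simp add: dist_norm norm_minus_commute)
      ultimately show ?thesis
        using log_ratio_near R(1) r'(1) by blast
    next
      case False
      then have "\<forall>z\<in>K. log_ratio t r z \<le> ennreal (ln (6 * R))"
        using log_ratio_far R by simp
      \<comment> \<open>Any point of K serves as r', because the extra term is nonnegative.\<close>
      then show ?thesis
        using K(2) by (meson add_increasing equals0I zero_le)
    qed
    then obtain r' where r': "r' \<in> K"
      "\<And>z. z \<in> K \<Longrightarrow> log_ratio t r z \<le> e2ennreal (- ereal_ln (cmod (z - r'))) + ennreal (ln (6 * R))"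
      by blast
    have "(\<integral>\<^sup>+z\<in>K. log_ratio t r z \<partial>M) \<le>
        (\<integral>\<^sup>+z. e2ennreal (- ereal_ln (cmod (z - r'))) * indicator K z +
          ennreal (ln (6 * R)) * indicator K z \<partial>M)"
      using r'(2) by (intro nn_integral_mono) (auto simp: indicator_def)
    also have "\<dots> = (\<integral>\<^sup>+z\<in>K. e2ennreal (- ereal_ln (cmod (z - r'))) \<partial>M) +
        ennreal (ln (6 * R)) * emeasure M K"
      by (subst nn_integral_add) (auto simp: nn_integral_cmult_indicator)
    also have "\<dots> \<le> D"
      unfolding D_def using pot[OF r'(1)] by (rule add_right_mono)
    finally show ?thesis .
  qed
  moreover have "D < \<infinity>"
    using B by (simp add: D_def ennreal_mult_less_top emeasure_eq_measure)
  then have "D = ennreal (enn2real D)"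
    by simp
  ultimately show ?thesis
    by (intro exI[of _ "enn2real D"]) auto
qed

lemma ln_prod_ratio_le:
  assumes "\<And>x. x \<in># A \<Longrightarrow> z \<noteq> x" "\<And>x. x \<in># A \<Longrightarrow> t \<noteq> x"
  shows "ennreal (ln (cmod (\<Prod>x\<in>#A. t - x) / cmod (\<Prod>x\<in>#A. z - x))) \<le>
    (\<Sum>x\<in>#A. log_ratio t x z)"
  using assms
proof (induction A)
  case (add x A)
  let ?a = "cmod (\<Prod>x\<in>#A. t - x) / cmod (\<Prod>x\<in>#A. z - x)"
  let ?b = "cmod (t - x) / cmod (z - x)"
  have "?a > 0"
    using add.prems by (intro divide_pos_pos) (auto simp: prod_mset_zero_iff)
  moreover have "?b > 0"
    using add.prems by auto
  ultimately have "ln (?b * ?a) = ln ?b + ln ?a"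
    by (intro ln_mult_pos)
  then have "ennreal (ln (cmod (\<Prod>x\<in>#add_mset x A. t - x) / cmod (\<Prod>x\<in>#add_mset x A. z - x))) =
      ennreal (ln ?b + ln ?a)"
    by (simp add: norm_mult)
  also have "\<dots> \<le> ennreal (ln ?b) + ennreal (ln ?a)"
    by (rule ennreal_add_le)
  also have "\<dots> \<le> log_ratio t x z + (\<Sum>x\<in>#A. log_ratio t x z)"
    using add by (intro add_mono) (auto simp: log_ratio_def)
  finally show ?case
    by simp
qed simp

text \<open>Measurability is part of the conclusion because additivity of the integral uses it in
  the induction step.\<close>

lemma nn_integral_sum_mset_le:
  assumes "\<And>x. f x \<in> borel_measurable M" "\<And>x. (\<integral>\<^sup>+z. f x z \<partial>M) \<le> c"
  shows "(\<integral>\<^sup>+z. (\<Sum>x\<in>#A. f x z) \<partial>M) \<le> of_nat (size A) * c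
    \<and> (\<lambda>z. \<Sum>x\<in>#A. f x z) \<in> borel_measurable M"
proof (induction A)
  case (add x A)
  then show ?case
    using assms by (auto simp: nn_integral_add distrib_right intro!: add_mono)
qed simp

text \<open>
  A Bernstein--Walsh inequality.  Factoring \<open>p\<close>, the logarithm of \<open>\<bar>p t\<bar> / \<bar>p z\<bar>\<close> is a sum of at
  most \<open>N\<close> logarithms of \<open>\<bar>t - r\<bar> / \<bar>z - r\<bar>\<close>; integrate over \<open>z\<close> in \<open>K\<close>.
\<close>

lemma bernstein_walsh:
  assumes M: "finite_measure M" "sets M = sets borel"
    and K: "compact K" "emeasure M K > 0" and B: "B < \<infinity>"
    and pot: "\<And>w. w \<in> K \<Longrightarrow> (\<integral>\<^sup>+z\<in>K. e2ennreal (- ereal_ln (cmod (z - w))) \<partial>M) \<le> B"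
  shows "\<exists>C\<ge>0. \<forall>p N s. degree p \<le> N \<longrightarrow> s > 0 \<longrightarrow> (\<forall>z\<in>K. cmod (poly p z) \<le> s) \<longrightarrow>
    cmod (poly p t) \<le> s * exp (C * real N)"
proof -
  interpret finite_measure M by fact
  note [measurable_cong] = M(2)
  have [measurable]: "K \<in> sets borel"
    using K(1) by (rule borel_compact)
  have "K \<noteq> {}"
    using K(2) by auto
  obtain C where C: "C \<ge> 0" "\<And>r. (\<integral>\<^sup>+z\<in>K. log_ratio t r z \<partial>M) \<le> ennreal C"
    using log_ratio_integral_bounded[OF M K(1) \<open>K \<noteq> {}\<close> B pot, of t] by blast
  define m where "m = measure M K"
  have m: "emeasure M K = ennreal m" "m > 0"
    using K(2) by (auto simp: m_def emeasure_eq_measure)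
  \<comment> \<open>Averaging over K divides C by the mass m of K.\<close>
  have "cmod (poly p t) \<le> s * exp (C / m * real N)"
    if p: "degree p \<le> N" and s: "s > 0" and bound: "\<And>z. z \<in> K \<Longrightarrow> cmod (poly p z) \<le> s" for p N s
  proof (cases "poly p t = 0")
    case True
    then show ?thesis
      using s by simp
  next
    case pt: False
    define A where "A = proots p"
    have A: "size A = degree p"
      by (simp add: A_def size_proots_complex)
    define c where "c = lead_coeff p"
    have poly_p: "poly p z = c * (\<Prod>x\<in>#A. z - x)" for z
      by (subst complex_poly_decompose_multiset[symmetric])
        (simp add: c_def A_def poly_prod_mset image_mset.compositionality o_def)
    have c: "c \<noteq> 0" and tA: "\<And>x. x \<in># A \<Longrightarrow> t \<noteq> x"
      using pt unfolding poly_p by auto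
    have *: "ennreal (ln (cmod (poly p t) / s)) \<le> (\<Sum>x\<in>#A. log_ratio t x z)" if z: "z \<in> K" for z
    \<comment> \<open>At a root z of p the right side is infinite.\<close>
    proof (cases "z \<in># A")
      case True
      then obtain A' where "A = add_mset z A'"
        by (metis mset_add)
      then show ?thesis
        by (simp add: log_ratio_def)
    next
      case False
      then have pz: "poly p z \<noteq> 0"
        unfolding poly_p using c by auto
      then have "cmod (poly p t) / s \<le> cmod (poly p t) / cmod (poly p z)"
        using bound[OF z] s by (intro divide_left_mono) auto
      then have "ln (cmod (poly p t) / s) \<le> ln (cmod (poly p t) / cmod (poly p z))"
        using pt pz s by (subst ln_le_cancel_iff) auto
      also have "cmod (poly p t) / cmod (poly p z) =
          cmod (\<Prod>x\<in>#A. t - x) / cmod (\<Prod>x\<in>#A. z - x)"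
        unfolding poly_p using c by (simp add: norm_mult)
      finally have "ennreal (ln (cmod (poly p t) / s)) \<le>
          ennreal (ln (cmod (\<Prod>x\<in>#A. t - x) / cmod (\<Prod>x\<in>#A. z - x)))"
        by (rule ennreal_leI)
      also have "\<dots> \<le> (\<Sum>x\<in>#A. log_ratio t x z)"
        using False tA by (intro ln_prod_ratio_le) auto
      finally show ?thesis .
    qed
    have "ennreal (ln (cmod (poly p t) / s)) * ennreal m =
        (\<integral>\<^sup>+z\<in>K. ennreal (ln (cmod (poly p t) / s)) \<partial>M)"
      by (simp add: nn_integral_cmult_indicator m)
    also have "\<dots> \<le> (\<integral>\<^sup>+z. (\<Sum>x\<in>#A. log_ratio t x z * indicator K z) \<partial>M)"
      using * by (intro nn_integral_mono) (auto simp: indicator_def)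
    also have "\<dots> \<le> of_nat (size A) * ennreal C"
      using C(2) by (intro conjunct1[OF nn_integral_sum_mset_le]) measurable
    also have "\<dots> \<le> of_nat N * ennreal C"
      using A p by (intro mult_right_mono) auto
    also have "\<dots> = ennreal (real N * C)"
      by (simp add: ennreal_mult' ennreal_of_nat_eq_real_of_nat)
    finally have "ennreal (ln (cmod (poly p t) / s) * m) \<le> ennreal (real N * C)"
      using m(2) by (simp add: ennreal_mult'')
    \<comment> \<open>Leaving \<open>ennreal\<close> is sound even if the left side is negative,
      since the right side is nonnegative.\<close>
    then have "ln (cmod (poly p t) / s) * m \<le> real N * C"
      using C(1) by (subst (asm) ennreal_le_iff) auto
    then have "ln (cmod (poly p t) / s) \<le> C / m * real N"
      using m(2) by (simp add: field_simps)
    then have "exp (ln (cmod (poly p t) / s)) \<le> exp (C / m * real N)"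
      by simp
    then have "cmod (poly p t) / s \<le> exp (C / m * real N)"
      using pt s by (subst (asm) exp_ln) auto
    then show ?thesis
      using s by (simp add: field_simps)
  qed
  then show ?thesis
    using C(1) m(2) by (intro exI[of _ "C / m"]) auto
qed

section \<open>Measures of finite logarithmic energy\<close>

lemma measure_support_null:
  fixes M :: "'a::second_countable_topology measure"
  assumes M: "sets M = sets borel"
  shows "AE x in M. x \<in> measure_support M"
proof -
  define \<U> where "\<U> = {U. open U \<and> emeasure M U = 0}"
  \<comment> \<open>The complement of the support is a union of open null sets; by Lindelof
    countably many suffice.\<close>
  obtain \<V> where \<V>: "\<V> \<subseteq> \<U>" "countable \<V>" "\<Union>\<V> = \<Union>\<U>"
    using Lindelof[of \<U>] by (auto simp: \<U>_def)
  have "\<Union>\<V> \<in> null_sets M"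
    using null_sets_UN'[of \<V> "\<lambda>U. U" M] \<V>(1,2) M by (fastforce simp: \<U>_def null_sets_def)
  then show ?thesis
  proof (rule AE_I')
    show "{x \<in> space M. x \<notin> measure_support M} \<subseteq> \<Union>\<V>"
      unfolding \<V>(3) by (auto simp: \<U>_def measure_support_def not_gr_zero)
  qed
qed

text \<open>Keeps \<open>log_energy\<close> from being infinity minus infinity, so that an energy
  other than -\<infinity> makes the negative part finite. On the bounded support, ln x <= x - 1
  gives the bound.\<close>

lemma log_energy_positive_part_finite:
  assumes M: "prob_space M" "sets M = sets borel" and S: "compact (measure_support M)"
  shows "(\<integral>\<^sup>+ w. (\<integral>\<^sup>+ z. e2ennreal (ereal_ln (cmod (z - w))) \<partial>M) \<partial>M) < \<infinity>"
proof -
  interpret prob_space M by fact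
  obtain R where R: "\<And>z. z \<in> measure_support M \<Longrightarrow> cmod z \<le> R"
    using compact_imp_bounded[OF S] unfolding bounded_iff by blast
  have supp: "AE x in M. x \<in> measure_support M"
    using M(2) by (rule measure_support_null)
  have le: "e2ennreal (ereal_ln (cmod (z - w))) \<le> ennreal (2 * R)"
    if "z \<in> measure_support M" "w \<in> measure_support M" for z w
  proof (cases "z = w")
    case False
    then have "ln (cmod (z - w)) \<le> cmod (z - w) - 1"
      by (intro ln_le_minus_one) auto
    also have "\<dots> \<le> 2 * R"
      using norm_triangle_ineq4[of z w] R that by (smt (verit))
    finally show ?thesis
      using False by (simp add: ereal_ln_def ennreal_leI)
  qed (simp add: ereal_ln_def e2ennreal_neg)
  have "(\<integral>\<^sup>+ w. (\<integral>\<^sup>+ z. e2ennreal (ereal_ln (cmod (z - w))) \<partial>M) \<partial>M) \<le>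
      (\<integral>\<^sup>+ w. (\<integral>\<^sup>+ z. ennreal (2 * R) \<partial>M) \<partial>M)"
  proof (rule nn_integral_mono_AE)
    show "AE w in M. (\<integral>\<^sup>+ z. e2ennreal (ereal_ln (cmod (z - w))) \<partial>M) \<le> (\<integral>\<^sup>+ z. ennreal (2 * R) \<partial>M)"
      using supp
    proof eventually_elim
      case (elim w)
      show ?case
        using supp by (intro nn_integral_mono_AE) (auto intro: le[OF _ elim])
    qed
  qed
  also have "\<dots> < \<infinity>"
    by (simp add: emeasure_space_1)
  finally show ?thesis .
qed

text \<open>Finite energy makes the potential V finite almost everywhere. The countably many sets
  \<open>W m k\<close>, which fix a member of the union and a bound on V together, cover almost all
  of the mass, so one has positive measure; inner regularity finds K inside it.\<close>

lemma nonpolar_Union: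
  fixes A :: "nat \<Rightarrow> complex set"
  assumes "\<not> polar (\<Union>m. A m)" and meas: "\<And>m. A m \<in> sets borel"
  obtains M K m B where "finite_measure M" "sets M = sets borel" "compact K" "emeasure M K > 0"
    "K \<subseteq> A m" "B < \<infinity>"
    "\<And>w. w \<in> K \<Longrightarrow> (\<integral>\<^sup>+z\<in>K. e2ennreal (- ereal_ln (cmod (z - w))) \<partial>M) \<le> B"
proof -
  obtain M where M: "prob_space M" "sets M = sets borel" "compact (measure_support M)"
    and supp: "measure_support M \<subseteq> (\<Union>m. A m)" and energy: "log_energy M \<noteq> -\<infinity>"
    using assms(1) unfolding polar_def by blast
  interpret prob_space M by fact
  note [measurable_cong] = M(2)
  define V where "V w = (\<integral>\<^sup>+ z. e2ennreal (- ereal_ln (cmod (z - w))) \<partial>M)" for w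
  have V_meas [measurable]: "V \<in> borel_measurable M"
    unfolding V_def by (intro borel_measurable_nn_integral) measurable
  have "(\<integral>\<^sup>+ w. V w \<partial>M) \<noteq> \<infinity>"
  proof
    assume "(\<integral>\<^sup>+ w. V w \<partial>M) = \<infinity>"
    moreover obtain P where "P \<ge> 0" "(\<integral>\<^sup>+ w. (\<integral>\<^sup>+ z. e2ennreal (ereal_ln (cmod (z - w))) \<partial>M) \<partial>M) = ennreal P"
      using log_energy_positive_part_finite[OF M] by (metis ennreal_cases infinity_ennreal_def less_irrefl)
    ultimately show False
      using energy by (simp add: log_energy_def V_def enn2ereal_ennreal)
  qed
  then have "AE w in M. V w \<noteq> \<infinity>"
    by (intro nn_integral_PInf_AE) auto
  moreover have "AE w in M. w \<in> (\<Union>m. A m)"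
    using measure_support_null[OF M(2)] by (rule eventually_mono) (use supp in blast)
  ultimately have ex: "AE w in M. \<exists>m k. w \<in> A m \<and> V w \<le> of_nat k"
  proof eventually_elim
    case (elim w)
    then obtain k :: nat where "V w \<le> of_nat k"
      by (metis ennreal_Ex_less_of_nat less_imp_le infinity_ennreal_def less_top)
    then show ?case
      using elim by blast
  qed
  define W where "W m k = {w \<in> space M. w \<in> A m \<and> V w \<le> of_nat k}" for m and k :: nat
  have W_meas [measurable]: "W m k \<in> sets M" for m k
    using meas[of m] unfolding W_def by measurable
  have "\<exists>m k. emeasure M (W m k) > 0"
  proof (rule ccontr)
    assume "\<not> ?thesis"
    then have "AE w in M. \<not> (w \<in> A m \<and> V w \<le> of_nat k)" for m and k :: nat
      using W_meas[of m k] by (intro AE_I[of _ _ "W m k"]) (auto simp: W_def)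
    then have "AE w in M. \<forall>m k. \<not> (w \<in> A m \<and> V w \<le> of_nat k)"
      unfolding AE_all_countable by blast
    with ex have "AE w in M. False"
      by eventually_elim blast
    then show False
      by (simp add: AE_False emeasure_space_1)
  qed
  then obtain m k where "emeasure M (W m k) > 0"
    by blast
  then obtain K where K: "K \<subseteq> W m k" "compact K" "emeasure M K > 0"
    using inner_regular[OF M(2), of "W m k"] W_meas M(2) by (auto simp: less_SUP_iff)
  show ?thesis
  proof (rule that)
    show "(\<integral>\<^sup>+z\<in>K. e2ennreal (- ereal_ln (cmod (z - w))) \<partial>M) \<le> of_nat k" if "w \<in> K" for w
    proof -
      have "(\<integral>\<^sup>+z\<in>K. e2ennreal (- ereal_ln (cmod (z - w))) \<partial>M) \<le> V w"
        unfolding V_def by (intro nn_integral_mono) (auto simp: indicator_def)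
      also have "\<dots> \<le> of_nat k"
        using K(1) that by (auto simp: W_def)
      finally show ?thesis .
    qed
  qed (use K M finite_measure_axioms in \<open>auto simp: W_def of_nat_less_top\<close>)
qed

text \<open>Apply \<open>bernstein_walsh\<close> to \<open>p n\<close> with s = (m + 1)^n and N = d
  * n: both factors of the bound are n-th powers. Taking m + 1 instead of m keeps s
  positive.\<close>

lemma polynomial_growth_propagates:
  fixes p :: "nat \<Rightarrow> complex poly"
  assumes deg: "\<And>n. degree (p n) \<le> d * n"
    and nonpolar: "\<not> polar {t. \<exists>C::nat. \<forall>n. cmod (poly (p n) t) \<le> real C ^ n}"
  shows "\<exists>C::nat. \<forall>n. cmod (poly (p n) t) \<le> real C ^ n"
proof -
  define A where "A m = {t. \<forall>n. cmod (poly (p n) t) \<le> real m ^ n}" for m :: nat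
  have "closed (A m)" for m
    unfolding A_def by (intro closed_Collect_all closed_Collect_le continuous_intros)
  then have meas: "A m \<in> sets borel" for m
    by (rule borel_closed)
  have "\<not> polar (\<Union>m. A m)"
    using nonpolar by (simp add: A_def Collect_ex_eq)
  then obtain M K m B where M: "finite_measure M" "sets M = sets borel" "compact K" "emeasure M K > 0"
    and KA: "K \<subseteq> A m" and B: "B < \<infinity>"
    "\<And>w. w \<in> K \<Longrightarrow> (\<integral>\<^sup>+z\<in>K. e2ennreal (- ereal_ln (cmod (z - w))) \<partial>M) \<le> B"
    using meas by (rule nonpolar_Union) auto
  obtain C where C: "C \<ge> 0" "\<And>p N s. degree p \<le> N \<Longrightarrow> s > 0 \<Longrightarrow>
      (\<And>z. z \<in> K \<Longrightarrow> cmod (poly p z) \<le> s) \<Longrightarrow> cmod (poly p t) \<le> s * exp (C * real N)"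
    using bernstein_walsh[OF M B, of t] by blast
  have "cmod (poly (p n) t) \<le> real (nat \<lceil>(real m + 1) * exp (C * real d)\<rceil>) ^ n" for n
  proof -
    have "cmod (poly (p n) z) \<le> (real m + 1) ^ n" if "z \<in> K" for z
    proof -
      have "cmod (poly (p n) z) \<le> real m ^ n"
        using KA that by (auto simp: A_def)
      also have "\<dots> \<le> (real m + 1) ^ n"
        by (intro power_mono) auto
      finally show ?thesis .
    qed
    then have "cmod (poly (p n) t) \<le> (real m + 1) ^ n * exp (C * real (d * n))"
      using deg by (intro C(2)) auto
    also have "\<dots> = ((real m + 1) * exp (C * real d)) ^ n"
      by (simp add: power_mult_distrib exp_of_nat_mult[symmetric] mult_ac)
    also have "\<dots> \<le> real (nat \<lceil>(real m + 1) * exp (C * real d)\<rceil>) ^ n"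
      by (intro power_mono) (auto intro: real_nat_ceiling_ge)
    finally show ?thesis .
  qed
  then show ?thesis
    by blast
qed

theorem theorem6:
  fixes d :: nat and f :: "nat \<Rightarrow> complex \<Rightarrow> complex" and \<alpha> :: real
  assumes "\<And>k. k \<le> d \<Longrightarrow> f k \<in> germs0"
    and "\<And>k. k \<le> d \<Longrightarrow> valuation (f k) \<ge> 2"
    and "\<alpha> \<notin> \<rat>"
  shows "\<forall>\<beta>::real.
           (\<forall>t. \<beta> \<in> rotation_numbers (perturbation \<alpha> d f t)) \<or>
           (\<exists>E. polar E \<and> (\<forall>t\<in>UNIV - E. \<beta> \<notin> rotation_numbers (perturbation \<alpha> d f t)))"
proof (intro allI)
  fix \<beta> :: real
  obtain p :: "nat \<Rightarrow> complex poly" where deg: "\<And>n. degree (p n) \<le> d * n"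
    and rot: "\<And>t. \<beta> \<in> rotation_numbers (perturbation \<alpha> d f t) \<longleftrightarrow>
      (\<exists>C::nat. \<forall>n. cmod (poly (p n) t) \<le> real C ^ n)"
    using rotation_numbers_perturbation[of d f \<alpha> \<beta>] assms by metis
  \<comment> \<open>The set of all good parameters is itself the candidate for E, so only the case
    where it is not polar needs an argument.\<close>
  let ?E = "{t. \<beta> \<in> rotation_numbers (perturbation \<alpha> d f t)}"
  show "(\<forall>t. \<beta> \<in> rotation_numbers (perturbation \<alpha> d f t)) \<or>
    (\<exists>E. polar E \<and> (\<forall>t\<in>UNIV - E. \<beta> \<notin> rotation_numbers (perturbation \<alpha> d f t)))"
  proof (cases "polar ?E")
    case True
    then show ?thesis
      by blast
  next
    case False
    then show ?thesis
      unfolding rot using polynomial_growth_propagates[of p d, OF deg] by blast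
  qed
qed

end
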